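(* Let $k$ be a positive integer and $\lambda$ a partition with at most $k$ rows. Then the formal power series $\mathrm{ss}_\lambda(\mathbf{y})=\sum_{S\in\mathrm{SSOT}_k(\lambda)}\mathbf{y}^S$ in $\mathbf{y}=(y_1,\dots,y_k)$ is symmetric, i.e. invariant under all permutations of $y_1,\dots,y_k$.
   Context: Partitions are identified with Young diagrams in English notation. A skew shape is a horizontal strip if it contains at most one box in each column. A $k$-semistandard oscillating tableau ($k$-SSOT) of final shape $\lambda$ is a finite sequence of partitions $S=(S^{1},S'^{2},S^{2},S'^{3},\dots,S'^{k},S^{k})$ such that, with $S'^{1}=\emptyset$: $S^{i}\supseteq S'^{i+1}$ and $S^i\setminus S'^{i+1}$ is a (possibly empty) horizontal strip for $1\le i\le k-1$; $S'^{i}\subseteq S^{i}$ and $S^i\setminus S'^i$ is a (possibly empty) horizontal strip for $1\le i\le k$; and $S^k=\lambda$. $\mathrm{SSOT}_k(\lambda)$ is the set of these. Step $i$ consists of deleting the boxes of $S^{i-1}\setminus S'^{i}$ (for $i\ge2$) and then adding the boxes of $S^i\setminus S'^i$. $S$ is identified with the multiset-valued tableau in which $i$ is recorded at a position $(l,m)$ once for each time that box is added or deleted in step $i$; $S(l,m)$ denotes the multiset at $(l,m)$. The weight is $\mathbf{y}^S=\prod_{l,m}\prod_{j\in S(l,m)}y_j$ (so the exponent of $y_i$ is the total number of boxes deleted and added in step $i$). *)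

theory Defs
  imports "HOL-Library.Multiset" "HOL-Combinatorics.Permutations"
begin

section \<open>Partitions and horizontal strips\<close>

definition is_partition :: "nat list \<Rightarrow> bool" where
  "is_partition p \<longleftrightarrow> sorted_wrt (\<ge>) p \<and> (\<forall>x\<in>set p. x > 0)"

text \<open>English notation: boxes are pairs (row, column), counted from 0, row 0 on top.\<close>

definition diagram :: "nat list \<Rightarrow> (nat \<times> nat) set" where
  "diagram p = {(l, m). l < length p \<and> m < p ! l}"

definition horizontal_strip :: "(nat \<times> nat) set \<Rightarrow> bool" where
  "horizontal_strip D \<longleftrightarrow> (\<forall>l l' m. (l, m) \<in> D \<longrightarrow> (l', m) \<in> D \<longrightarrow> l = l')"

section \<open>Semistandard oscillating tableaux\<close>

text \<open>
  A sequence \<open>(S\<^sup>1, S'\<^sup>2, S\<^sup>2, \<dots>, S'\<^sup>k, S\<^sup>k)\<close> is a list of length \<open>2k - 1\<close>, so that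
  \<open>S\<^sup>i\<close> is its entry \<open>2i - 2\<close> and \<open>S'\<^sup>i\<close>, for \<open>i \<ge> 2\<close>, is its entry \<open>2i - 3\<close>. The convention
  \<open>S'\<^sup>1 = \<emptyset>\<close> is supplemented by \<open>S\<^sup>0 = \<emptyset>\<close>, so that nothing is deleted in step 1.
\<close>

definition outer :: "nat list list \<Rightarrow> nat \<Rightarrow> nat list" where
  "outer S i = (if i = 0 then [] else S ! (2 * i - 2))"

definition inner :: "nat list list \<Rightarrow> nat \<Rightarrow> nat list" where
  "inner S i = (if i \<le> 1 then [] else S ! (2 * i - 3))"

definition deleted :: "nat list list \<Rightarrow> nat \<Rightarrow> (nat \<times> nat) set" where
  "deleted S i = diagram (outer S (i - 1)) - diagram (inner S i)"

definition added :: "nat list list \<Rightarrow> nat \<Rightarrow> (nat \<times> nat) set" where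
  "added S i = diagram (outer S i) - diagram (inner S i)"

definition SSOT :: "nat \<Rightarrow> nat list \<Rightarrow> nat list list set" where
  "SSOT k p = {S. length S = 2 * k - 1 \<and> (\<forall>q\<in>set S. is_partition q) \<and>
     (\<forall>i\<in>{1..<k}. diagram (inner S (i + 1)) \<subseteq> diagram (outer S i) \<and>
        horizontal_strip (diagram (outer S i) - diagram (inner S (i + 1)))) \<and>
     (\<forall>i\<in>{1..k}. diagram (inner S i) \<subseteq> diagram (outer S i) \<and>
        horizontal_strip (diagram (outer S i) - diagram (inner S i))) \<and>
     outer S k = p}"

definition entries :: "nat \<Rightarrow> nat list list \<Rightarrow> nat \<times> nat \<Rightarrow> nat multiset" where
  "entries k S c = (\<Sum>i\<in>{1..k}. (if c \<in> deleted S i then {#i#} else {#}) +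
                                (if c \<in> added S i then {#i#} else {#}))"

section \<open>Formal power series and the weight generating function\<close>

text \<open>
  A monomial in the variables \<open>y\<^sub>1, y\<^sub>2, \<dots>\<close> is given by its exponents, a formal power series
  by its coefficients. A series in \<open>y\<^sub>1, \<dots>, y\<^sub>k\<close> is one whose monomials of nonzero coefficient
  have exponent 0 at every index outside \<open>{1..k}\<close>.
\<close>

type_synonym monomial = "nat \<Rightarrow> nat"
type_synonym power_series = "monomial \<Rightarrow> int"

text \<open>The exponents of the product of \<open>y\<^sub>j\<close> over all boxes and all entries \<open>j\<close> in them.\<close>

definition weight :: "nat \<Rightarrow> nat list list \<Rightarrow> monomial" where
  "weight k S = (\<lambda>j. \<Sum>c\<in>{c. entries k S c \<noteq> {#}}. count (entries k S c) j)"

definition monomial_series :: "monomial \<Rightarrow> power_series" where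
  "monomial_series a = (\<lambda>b. if b = a then 1 else 0)"

text \<open>
  The coefficientwise sum of a family of power series; it is meaningful only for families
  in which every monomial has a nonzero coefficient in finitely many members.
  For \<open>ss\<close> below, this is lemma \<open>finite_SSOT_coeff\<close>.
\<close>

definition series_sum :: "'a set \<Rightarrow> ('a \<Rightarrow> power_series) \<Rightarrow> power_series" where
  "series_sum A f = (\<lambda>b. \<Sum>x\<in>{x \<in> A. f x b \<noteq> 0}. f x b)"

definition ss :: "nat \<Rightarrow> nat list \<Rightarrow> power_series" where
  "ss k p = series_sum (SSOT k p) (\<lambda>S. monomial_series (weight k S))"

text \<open>
  Substituting \<open>y\<^bsub>\<pi> i\<^esub>\<close> for \<open>y\<^sub>i\<close> turns the monomial with exponents \<open>b \<circ> \<pi>\<close> into the one with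
  exponents \<open>b\<close>.
\<close>

definition permute_vars :: "(nat \<Rightarrow> nat) \<Rightarrow> power_series \<Rightarrow> power_series" where
  "permute_vars \<pi> f = (\<lambda>b. f (b \<circ> \<pi>))"

definition symmetric_series :: "nat \<Rightarrow> power_series \<Rightarrow> bool" where
  "symmetric_series k f \<longleftrightarrow> (\<forall>\<pi>. \<pi> permutes {1..k} \<longrightarrow> permute_vars \<pi> f = f)"

section \<open>Well-definedness\<close>

lemma finite_diagram: "finite (diagram p)"
proof -
  have "diagram p = (SIGMA l:{..<length p}. {..<p ! l})"
    by (auto simp: diagram_def)
  then show ?thesis by simp
qed

lemma count_entries:
  "count (entries k S c) j =
     (if j \<in> {1..k} then of_bool (c \<in> deleted S j) + of_bool (c \<in> added S j) else 0)"
proof -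
  have "count (entries k S c) j =
      (\<Sum>i\<in>{1..k}. if i = j then of_bool (c \<in> deleted S j) + of_bool (c \<in> added S j) else 0)"
    unfolding entries_def count_sum by (intro sum.cong) auto
  then show ?thesis by (simp only: sum.delta finite_atLeastAtMost)
qed

lemma weight_eq:
  "weight k S j = (if j \<in> {1..k} then card (deleted S j) + card (added S j) else 0)"
proof (cases "j \<in> {1..k}")
  case True
  let ?U = "(\<Union>i\<in>{1..k}. deleted S i \<union> added S i)"
  have fin: "finite (deleted S i)" "finite (added S i)" for i
    by (auto simp: deleted_def added_def finite_diagram)
  have finU: "finite ?U" using fin by blast
  have sub: "{c. entries k S c \<noteq> {#}} \<subseteq> ?U"
    by (force simp: multiset_eq_iff count_entries split: if_splits)
  have "weight k S j = (\<Sum>c\<in>?U. count (entries k S c) j)"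
    unfolding weight_def by (rule sum.mono_neutral_left[OF finU sub]) auto
  also have "\<dots> = (\<Sum>c\<in>?U. of_bool (c \<in> deleted S j)) + (\<Sum>c\<in>?U. of_bool (c \<in> added S j))"
    using True by (simp add: count_entries sum.distrib)
  also have "(\<Sum>c\<in>?U. of_bool (c \<in> deleted S j)) = card (?U \<inter> deleted S j)"
    using finU by (simp add: of_bool_def sum.If_cases Int_def)
  also have "?U \<inter> deleted S j = deleted S j" using True by blast
  also have "(\<Sum>c\<in>?U. of_bool (c \<in> added S j)) = card (?U \<inter> added S j)"
    using finU by (simp add: of_bool_def sum.If_cases Int_def)
  also have "?U \<inter> added S j = added S j" using True by blast
  finally show ?thesis using True by simp
next
  case False
  then have "count (entries k S c) j = 0" for c by (simp only: count_entries if_False)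
  then show ?thesis using False by (simp only: weight_def if_False sum.neutral_const)
qed

lemma partition_bounds:
  assumes "is_partition p" "card (diagram p) \<le> n"
  shows "set p \<subseteq> {..n} \<and> length p \<le> n"
proof -
  have "(\<lambda>l. (l, 0)) ` {..<length p} \<subseteq> diagram p"
    using assms(1) by (auto simp: diagram_def is_partition_def)
  from card_mono[OF finite_diagram this] have len: "length p \<le> card (diagram p)"
    by (simp add: card_image inj_on_def)
  have "p ! l \<le> card (diagram p)" if "l < length p" for l
  proof -
    have "(\<lambda>m. (l, m)) ` {..<p ! l} \<subseteq> diagram p"
      using that by (auto simp: diagram_def)
    from card_mono[OF finite_diagram this] show ?thesis
      by (simp add: card_image inj_on_def)
  qed
  with len assms(2) show ?thesis
    by (fastforce simp: in_set_conv_nth)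
qed

lemma outer_subset:
  assumes "S \<in> SSOT k p" "i \<le> k"
  shows "diagram (outer S i) \<subseteq> (\<Union>j\<in>{1..i}. added S j)"
  using assms(2)
proof (induction i)
  case 0
  then show ?case by (simp add: outer_def diagram_def)
next
  case (Suc i)
  have "diagram (inner S (Suc i)) \<subseteq> diagram (outer S i)"
  proof (cases "i = 0")
    case True
    then show ?thesis by (simp add: inner_def diagram_def)
  next
    case False
    then have "i \<in> {1..<k}" using Suc.prems by simp
    then show ?thesis using assms(1) unfolding SSOT_def by auto
  qed
  then have "diagram (outer S (Suc i)) \<subseteq> diagram (outer S i) \<union> added S (Suc i)"
    by (auto simp: added_def)
  also have "\<dots> \<subseteq> (\<Union>j\<in>{1..i}. added S j) \<union> added S (Suc i)" using Suc by auto
  also have "\<dots> = (\<Union>j\<in>{1..Suc i}. added S j)" by (simp add: atLeastAtMostSuc_conv Un_commute)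
  finally show ?case .
qed

lemma finite_SSOT_weight: "finite {S \<in> SSOT k p. weight k S = a}"
proof -
  define n where "n = (\<Sum>j\<in>{1..k}. a j)"
  let ?P = "{q. set q \<subseteq> {..n} \<and> length q \<le> n}"
  have "{S \<in> SSOT k p. weight k S = a} \<subseteq> {S. set S \<subseteq> ?P \<and> length S = 2 * k - 1}"
  proof
    fix S assume "S \<in> {S \<in> SSOT k p. weight k S = a}"
    then have S: "S \<in> SSOT k p" and a: "a = weight k S" by auto
    have fin: "finite (added S j)" for j by (simp add: added_def finite_diagram)
    have card_outer: "card (diagram (outer S i)) \<le> n" if "i \<le> k" for i
    proof -
      have "card (diagram (outer S i)) \<le> card (\<Union>j\<in>{1..k}. added S j)"
        by (rule card_mono) (use fin outer_subset[OF S that] that in force)+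
      also have "\<dots> \<le> (\<Sum>j\<in>{1..k}. card (added S j))" by (rule card_UN_le) simp
      also have "\<dots> \<le> n" unfolding n_def a by (rule sum_mono) (simp add: weight_eq)
      finally show ?thesis .
    qed
    have card_inner: "card (diagram (inner S i)) \<le> n" if "i \<in> {1..k}" for i
    proof -
      have "diagram (inner S i) \<subseteq> diagram (outer S i)"
        using S that unfolding SSOT_def by blast
      from card_mono[OF finite_diagram this] show ?thesis using card_outer[of i] that by simp
    qed
    have len: "length S = 2 * k - 1" using S by (simp add: SSOT_def)
    have "q \<in> ?P" if q: "q \<in> set S" for q
    proof -
      from q obtain r where r: "r < 2 * k - 1" "q = S ! r" using len by (auto simp: in_set_conv_nth)
      have "card (diagram q) \<le> n"
      proof (cases "even r")
        case True
        then obtain t where t: "r = 2 * t" by blast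
        then have "outer S (t + 1) = q" using r by (simp add: outer_def)
        then show ?thesis using card_outer[of "t + 1"] r t by simp
      next
        case False
        then obtain t where t: "r = 2 * t + 1" using oddE by blast
        then have "inner S (t + 2) = q" using r by (simp add: inner_def)
        then show ?thesis using card_inner[of "t + 2"] r t by simp
      qed
      moreover have "is_partition q" using S q by (simp add: SSOT_def)
      ultimately show ?thesis using partition_bounds by blast
    qed
    with len show "S \<in> {S. set S \<subseteq> ?P \<and> length S = 2 * k - 1}" by blast
  qed
  moreover have "finite {S. set S \<subseteq> ?P \<and> length S = 2 * k - 1}"
    by (intro finite_lists_length_eq finite_lists_length_le) simp
  ultimately show ?thesis by (rule finite_subset)
qed

lemma finite_SSOT_coeff:
  "finite {S \<in> SSOT k p. monomial_series (weight k S) a \<noteq> 0}"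
proof -
  have "{S \<in> SSOT k p. monomial_series (weight k S) a \<noteq> 0} = {S \<in> SSOT k p. weight k S = a}"
    by (auto simp: monomial_series_def)
  then show ?thesis by (simp add: finite_SSOT_weight)
qed

end

theory Submission
  imports Defs
begin

text \<open>
  Let \<open>U(y)\<close> and \<open>D(y)\<close> add and delete a horizontal strip, weighted by \<open>y\<close> per box. A step is
  \<open>U(y) D(y)\<close>, and since the operators \<open>U\<close> commute, the operators \<open>D\<close> commute and
  \<open>D(x) U(y) = (1 - x y)\<^sup>-\<^sup>1 U(y) D(x)\<close>, two consecutive steps satisfy
  \<open>U(x) D(x) U(y) D(y) = (1 - x y)\<^sup>-\<^sup>1 U(x) U(y) D(x) D(y)\<close>, which is symmetric in \<open>x\<close> and \<open>y\<close>.
  Each of these relations is realized by a bijection that reflects row lengths in intervals;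
  composed, they give an involution on tableaux that exchanges the weights of two adjacent steps.
\<close>

section \<open>Partitions as row length functions, horizontal strips as interlacing\<close>

definition row :: "nat list \<Rightarrow> nat \<Rightarrow> nat" where
  "row p i = (if i < length p then p ! i else 0)"

text \<open>For an antitone function the first zero is the number of nonzero rows. Without any zero,
  \<open>LEAST\<close> is unspecified, hence the assumption \<open>vanishing\<close> in
  \<open>row_of_rows\<close>.\<close>

definition of_rows :: "(nat \<Rightarrow> nat) \<Rightarrow> nat list" where
  "of_rows f = map f [0..<LEAST n. f n = 0]"

text \<open>The condition on adjacent rows of a Gelfand-Tsetlin pattern, for infinite
  sequences.\<close>

definition interlaces :: "(nat \<Rightarrow> nat) \<Rightarrow> (nat \<Rightarrow> nat) \<Rightarrow> bool" where
  "interlaces g f \<longleftrightarrow> (\<forall>i. g i \<le> f i \<and> f (Suc i) \<le> g i)"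

text \<open>Summing over the support avoids a length bound. An infinite support would give the
  default value 0, so statements about sizes come with finite support.\<close>

definition fsize :: "(nat \<Rightarrow> nat) \<Rightarrow> nat" where
  "fsize f = (\<Sum>i | f i \<noteq> 0. f i)"

definition vanishing :: "(nat \<Rightarrow> nat) \<Rightarrow> bool" where
  "vanishing f \<longleftrightarrow> (\<exists>N. \<forall>i\<ge>N. f i = 0)"

lemma row_Nil [simp]: "row [] = (\<lambda>_. 0)"
  by (simp add: row_def fun_eq_iff)

lemma vanishing_row: "vanishing (row p)"
  unfolding vanishing_def row_def by (rule exI[of _ "length p"]) simp

lemma antimono_row:
  assumes "is_partition p"
  shows "antimono (row p)"
proof (rule antimonoI)
  fix i j :: nat assume "i \<le> j"
  with assms show "row p j \<le> row p i"
    by (cases "i = j") (auto simp: row_def is_partition_def sorted_wrt_iff_nth_less)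
qed

lemma of_rows_row:
  assumes "is_partition p"
  shows "of_rows (row p) = p"
proof -
  have "(LEAST n. row p n = 0) = length p"
  proof (rule Least_equality)
    show "row p (length p) = 0" by (simp add: row_def)
    show "length p \<le> n" if "row p n = 0" for n
    proof (rule ccontr)
      assume "\<not> length p \<le> n"
      with that have "0 \<in> set p" by (metis linorder_not_le nth_mem row_def)
      with assms show False by (auto simp: is_partition_def)
    qed
  qed
  then show ?thesis
    by (auto simp: of_rows_def row_def intro: nth_equalityI)
qed

lemma row_of_rows:
  assumes "antimono f" "vanishing f"
  shows "is_partition (of_rows f)" "row (of_rows f) = f"
proof -
  define n where "n = (LEAST n. f n = 0)"
  have "\<exists>n. f n = 0" using assms(2) by (auto simp: vanishing_def)
  then have zero: "f n = 0" unfolding n_def by (rule LeastI_ex)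
  have pos: "f i > 0" if "i < n" for i
    using not_less_Least[of i "\<lambda>n. f n = 0"] that by (simp add: n_def)
  have "f i = 0" if "n \<le> i" for i
    using antimonoD[OF assms(1) that] zero by simp
  then show "row (of_rows f) = f"
    by (auto simp: row_def of_rows_def fun_eq_iff simp flip: n_def)
  show "is_partition (of_rows f)"
    using antimonoD[OF assms(1)] pos
    by (auto simp: is_partition_def of_rows_def sorted_wrt_iff_nth_less simp flip: n_def)
qed

lemma diagram_row: "diagram p = {(l, m). m < row p l}"
  by (auto simp: diagram_def row_def split: if_splits)

text \<open>Since rows are antitone, two strip boxes in one column exist iff some row of
  \<open>p\<close> extends beyond the end of the row of \<open>q\<close> just above it.\<close>

lemma horizontal_strip_iff_interlaces:
  assumes "is_partition p" "is_partition q"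
  shows "diagram q \<subseteq> diagram p \<and> horizontal_strip (diagram p - diagram q) \<longleftrightarrow>
    interlaces (row q) (row p)"
proof
  assume L: "diagram q \<subseteq> diagram p \<and> horizontal_strip (diagram p - diagram q)"
  have le: "row q i \<le> row p i" for i
  proof (rule ccontr)
    assume "\<not> row q i \<le> row p i"
    then have "(i, row p i) \<in> diagram q" by (simp add: diagram_row)
    with L have "(i, row p i) \<in> diagram p" by blast
    then show False by (simp add: diagram_row)
  qed
  have "row p (Suc i) \<le> row q i" for i
  proof (rule ccontr)
    assume "\<not> row p (Suc i) \<le> row q i"
    moreover have "row q (Suc i) \<le> row q i" "row p (Suc i) \<le> row p i"
      using assms by (simp_all add: antimonoD[OF antimono_row])
    \<comment> \<open>The first column to the right of row \<open>i\<close> of \<open>q\<close>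
      meets the strip in both rows.\<close>
    ultimately have "(i, row q i) \<in> diagram p - diagram q"
      "(Suc i, row q i) \<in> diagram p - diagram q"
      by (auto simp: diagram_row)
    with L have "i = Suc i" unfolding horizontal_strip_def by blast
    then show False by simp
  qed
  with le show "interlaces (row q) (row p)" by (simp add: interlaces_def)
next
  assume R: "interlaces (row q) (row p)"
  have disj: False
    if "l < l'" "(l, m) \<in> diagram p - diagram q" "(l', m) \<in> diagram p - diagram q" for l l' m
  proof -
    have "row p l' \<le> row p (Suc l)" using assms(1) that(1) by (simp add: antimonoD[OF antimono_row])
    also have "\<dots> \<le> row q l" using R by (simp add: interlaces_def)
    finally show False using that by (auto simp: diagram_row)
  qed
  have "diagram q \<subseteq> diagram p"
    using R by (auto simp: diagram_row interlaces_def intro: less_le_trans)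
  moreover have "horizontal_strip (diagram p - diagram q)"
    unfolding horizontal_strip_def by (metis disj nat_neq_iff)
  ultimately show "diagram q \<subseteq> diagram p \<and> horizontal_strip (diagram p - diagram q)" ..
qed

section \<open>Sizes, finite support and monotonicity\<close>

lemma fsize_eq:
  assumes "\<And>i. i \<ge> N \<Longrightarrow> f i = 0"
  shows "fsize f = (\<Sum>i<N. f i)"
  unfolding fsize_def
proof (rule sum.mono_neutral_left)
  show "{i. f i \<noteq> 0} \<subseteq> {..<N}"
    using assms by (metis (mono_tags, lifting) lessThan_iff linorder_not_le mem_Collect_eq subsetI)
qed auto

lemma card_diagram: "card (diagram p) = fsize (row p)"
proof -
  have "diagram p = (SIGMA l:{..<length p}. {..<p ! l})"
    by (auto simp: diagram_def)
  then have "card (diagram p) = (\<Sum>l<length p. p ! l)" by simp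
  also have "\<dots> = (\<Sum>l<length p. row p l)" by (intro sum.cong) (auto simp: row_def)
  also have "\<dots> = fsize (row p)" by (rule fsize_eq[symmetric]) (simp add: row_def)
  finally show ?thesis .
qed

text \<open>The values form one chain \<open>f 0\<close>, \<open>g 0\<close>, \<open>f 1\<close>,
  \<open>g 1\<close>, ... that never increases. This makes the members of \<open>osc\<close>
  sequences of partitions.\<close>

lemma interlaces_antimono:
  assumes "interlaces g f"
  shows "antimono f" "antimono g"
proof -
  have le: "g i \<le> f i" "f (Suc i) \<le> g i" for i
    using assms by (simp_all add: interlaces_def)
  show "antimono f" "antimono g"
    unfolding antimono_iff_le_Suc using le order_trans by blast+
qed

lemma interlaces_vanishing:
  assumes "interlaces g f"
  shows "vanishing f \<longleftrightarrow> vanishing g"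
proof
  assume "vanishing f"
  then obtain N where "\<forall>i\<ge>N. f i = 0" by (auto simp: vanishing_def)
  moreover have "g i \<le> f i" for i using assms by (simp add: interlaces_def)
  ultimately show "vanishing g" unfolding vanishing_def by (metis le_zero_eq)
next
  assume "vanishing g"
  then obtain N where N: "\<forall>i\<ge>N. g i = 0" by (auto simp: vanishing_def)
  have "f i = 0" if "i \<ge> Suc N" for i
  proof -
    from that obtain j where "i = Suc j" "j \<ge> N" by (cases i) auto
    moreover have "f (Suc j) \<le> g j" using assms by (simp add: interlaces_def)
    ultimately show ?thesis using N by simp
  qed
  then show "vanishing f" unfolding vanishing_def by blast
qed

lemma interlaces_fsize:
  assumes "interlaces g f" "vanishing f"
  shows "fsize g \<le> fsize f"
proof -
  from assms(2) obtain N where N: "\<And>i. i \<ge> N \<Longrightarrow> f i = 0" by (auto simp: vanishing_def)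
  have le: "g i \<le> f i" for i using assms(1) by (simp add: interlaces_def)
  have "fsize f = (\<Sum>i<N. f i)" "fsize g = (\<Sum>i<N. g i)"
    using N le by (auto intro!: fsize_eq) (metis le_zero_eq)
  then show ?thesis using le by (simp add: sum_mono)
qed

lemma vanishing_common:
  assumes "vanishing f" "vanishing g" "vanishing h"
  obtains N where "\<And>i. i \<ge> N \<Longrightarrow> f i = 0 \<and> g i = 0 \<and> h i = 0"
proof -
  from assms obtain a b c where "\<forall>i\<ge>a. f i = 0" "\<forall>i\<ge>b. g i = 0" "\<forall>i\<ge>c. h i = 0"
    by (auto simp: vanishing_def)
  then show ?thesis by (intro that[of "max a (max b c)"]) auto
qed

section \<open>Reflecting interlacing sequences\<close>

text \<open>
  If \<open>t\<close> interlaces \<open>a\<close> and \<open>a\<close> interlaces \<open>c\<close>, then the possible values of \<open>a i\<close>, for fixed \<open>t\<close> and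
  \<open>c\<close>, form the interval below, independently of the other entries of \<open>a\<close>. Reflecting every
  entry is the Bender--Knuth involution.
\<close>

definition lo :: "(nat \<Rightarrow> nat) \<Rightarrow> (nat \<Rightarrow> nat) \<Rightarrow> nat \<Rightarrow> nat" where
  "lo c t i = max (c (Suc i)) (t i)"

definition hi :: "(nat \<Rightarrow> nat) \<Rightarrow> (nat \<Rightarrow> nat) \<Rightarrow> nat \<Rightarrow> nat" where
  "hi c t i = (case i of 0 \<Rightarrow> c 0 | Suc j \<Rightarrow> min (c i) (t j))"

definition reflect :: "(nat \<Rightarrow> nat) \<Rightarrow> (nat \<Rightarrow> nat) \<Rightarrow> (nat \<Rightarrow> nat) \<Rightarrow> nat \<Rightarrow> nat" where
  "reflect c t a i = lo c t i + hi c t i - a i"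

text \<open>Each inequality of the two interlacings involves just one entry of \<open>a\<close>, so
  they can be grouped by that entry. At index 0 only \<open>c 0\<close> bounds from above, as
  \<open>t\<close> has no row before it.\<close>

lemma between_iff:
  "interlaces t a \<and> interlaces a c \<longleftrightarrow> (\<forall>i. lo c t i \<le> a i \<and> a i \<le> hi c t i)"
proof
  assume "interlaces t a \<and> interlaces a c"
  then have "t i \<le> a i" "a (Suc i) \<le> t i" "a i \<le> c i" "c (Suc i) \<le> a i" for i
    by (simp_all add: interlaces_def)
  then show "\<forall>i. lo c t i \<le> a i \<and> a i \<le> hi c t i"
    by (simp add: lo_def hi_def split: nat.split)
next
  assume R: "\<forall>i. lo c t i \<le> a i \<and> a i \<le> hi c t i"
  have "a (Suc i) \<le> t i" "t i \<le> a i" "c (Suc i) \<le> a i" for i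
    using R[rule_format, of "Suc i"] R[rule_format, of i] by (auto simp: lo_def hi_def)
  moreover have "a i \<le> c i" for i
    using R[rule_format, of i] by (auto simp: hi_def split: nat.splits)
  ultimately show "interlaces t a \<and> interlaces a c" by (simp add: interlaces_def)
qed

lemma reflect:
  assumes "interlaces t a" "interlaces a c"
  shows "interlaces t (reflect c t a)" "interlaces (reflect c t a) c"
    "reflect c t (reflect c t a) = a"
proof -
  have b: "lo c t i \<le> a i \<and> a i \<le> hi c t i" for i
    using between_iff assms by blast
  then have "lo c t i \<le> reflect c t a i \<and> reflect c t a i \<le> hi c t i" for i
    unfolding reflect_def using b[of i] by linarith
  then show "interlaces t (reflect c t a)" "interlaces (reflect c t a) c"
    using between_iff[of t "reflect c t a" c] by auto
  show "reflect c t (reflect c t a) = a"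
  proof
    show "reflect c t (reflect c t a) i = a i" for i
      unfolding reflect_def using b[of i] by linarith
  qed
qed

text \<open>The upper end at \<open>Suc i\<close> and the lower end at \<open>i\<close> are the
  minimum and maximum of \<open>c (Suc i)\<close> and \<open>t i\<close>, so they add up to
  \<open>c (Suc i) + t i\<close>. The sum of all interval ends telescopes accordingly.\<close>

lemma fsize_reflect:
  assumes "interlaces t a" "interlaces a c" "vanishing c"
  shows "fsize a + fsize (reflect c t a) = fsize c + fsize t"
proof -
  have "vanishing a" "vanishing t"
    using assms interlaces_vanishing by blast+
  then obtain N where N: "\<And>i. i \<ge> N \<Longrightarrow> c i = 0 \<and> a i = 0 \<and> t i = 0"
    using assms(3) by (metis vanishing_common)
  have b: "lo c t i \<le> a i \<and> a i \<le> hi c t i" for i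
    using between_iff assms by blast
  have add: "a i + reflect c t a i = lo c t i + hi c t i" for i
    unfolding reflect_def using b[of i] by linarith
  have tele: "(\<Sum>i<Suc n. lo c t i + hi c t i) = (\<Sum>i<Suc n. c i) + (\<Sum>i<n. t i) + lo c t n" for n
    by (induction n) (auto simp: lo_def hi_def)
  have zero: "reflect c t a i = 0" if "i \<ge> Suc N" for i
    using N that by (auto simp: reflect_def lo_def hi_def split: nat.split)
  have "fsize a + fsize (reflect c t a) = (\<Sum>i<Suc N. a i) + (\<Sum>i<Suc N. reflect c t a i)"
    using fsize_eq[of "Suc N" a] fsize_eq[of "Suc N" "reflect c t a"] N zero by auto
  also have "\<dots> = (\<Sum>i<Suc N. lo c t i + hi c t i)"
    by (simp only: add flip: sum.distrib)
  also have "\<dots> = (\<Sum>i<Suc N. c i) + (\<Sum>i<N. t i)"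
    unfolding tele using N by (simp add: lo_def)
  also have "\<dots> = fsize c + fsize t"
    using fsize_eq[of "Suc N" c] fsize_eq[of N t] N by auto
  finally show ?thesis .
qed

text \<open>
  Likewise, the entries of a common upper neighbour \<open>s\<close> of \<open>a\<close> and \<open>b\<close> vary independently in
  intervals. Those of \<open>s (Suc i)\<close> are the intervals of the entries \<open>t i\<close> of a common lower neighbour;
  the entry \<open>s 0\<close> is bounded only from below. This is the commutation relation
  \<open>D(x) U(y) = (1 - x y)\<^sup>-\<^sup>1 U(y) D(x)\<close> between adding and deleting horizontal strips.
\<close>

definition lower :: "(nat \<Rightarrow> nat) \<Rightarrow> (nat \<Rightarrow> nat) \<Rightarrow> (nat \<Rightarrow> nat) \<Rightarrow> nat \<Rightarrow> nat" where
  "lower a b s i = max (a (Suc i)) (b (Suc i)) + min (a i) (b i) - s (Suc i)"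

definition excess :: "(nat \<Rightarrow> nat) \<Rightarrow> (nat \<Rightarrow> nat) \<Rightarrow> (nat \<Rightarrow> nat) \<Rightarrow> nat" where
  "excess a b s = s 0 - max (a 0) (b 0)"

definition upper :: "(nat \<Rightarrow> nat) \<Rightarrow> (nat \<Rightarrow> nat) \<Rightarrow> (nat \<Rightarrow> nat) \<Rightarrow> nat \<Rightarrow> nat \<Rightarrow> nat" where
  "upper a b t j i = (case i of 0 \<Rightarrow> max (a 0) (b 0) + j
     | Suc n \<Rightarrow> max (a (Suc n)) (b (Suc n)) + min (a n) (b n) - t n)"

lemma upper_simps [simp]:
  "upper a b t j 0 = max (a 0) (b 0) + j"
  "upper a b t j (Suc n) = max (a (Suc n)) (b (Suc n)) + min (a n) (b n) - t n"
  by (simp_all add: upper_def)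

text \<open>Both \<open>s (Suc i)\<close> and \<open>t i\<close> range from
  \<open>max (a (Suc i)) (b (Suc i))\<close> to \<open>min (a i) (b i)\<close>, so reflecting one
  gives the other. The number \<open>excess a b s\<close> keeps the information of
  \<open>s 0\<close>. With lemma \<open>upper\<close>, this makes \<open>s\<close> correspond
  bijectively to pairs of a common lower neighbour and a natural number.\<close>

lemma lower:
  assumes "interlaces a s" "interlaces b s"
  shows "interlaces (lower a b s) a" "interlaces (lower a b s) b"
    "upper a b (lower a b s) (excess a b s) = s"
proof -
  have s: "a i \<le> s i" "b i \<le> s i" "s (Suc i) \<le> a i" "s (Suc i) \<le> b i" for i
    using assms by (auto simp: interlaces_def)
  have "lower a b s i \<le> a i \<and> a (Suc i) \<le> lower a b s i \<and>
    lower a b s i \<le> b i \<and> b (Suc i) \<le> lower a b s i" for i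
    unfolding lower_def using s[of i] s[of "Suc i"] by linarith
  then show "interlaces (lower a b s) a" "interlaces (lower a b s) b"
    by (auto simp: interlaces_def)
  show "upper a b (lower a b s) (excess a b s) = s"
  proof
    fix i
    show "upper a b (lower a b s) (excess a b s) i = s i"
    proof (cases i)
      case 0
      then show ?thesis using s[of 0] by (simp add: excess_def)
    next
      case (Suc n)
      then show ?thesis unfolding lower_def Suc upper_simps
        using s[of n] s[of "Suc n"] by linarith
    qed
  qed
qed

lemma upper:
  assumes "interlaces t a" "interlaces t b"
  shows "interlaces a (upper a b t j)" "interlaces b (upper a b t j)"
    "lower a b (upper a b t j) = t" "excess a b (upper a b t j) = j"
proof -
  have t: "t i \<le> a i" "t i \<le> b i" "a (Suc i) \<le> t i" "b (Suc i) \<le> t i" for i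
    using assms by (auto simp: interlaces_def)
  have "upper a b t j (Suc i) \<le> a i \<and> upper a b t j (Suc i) \<le> b i" for i
    unfolding upper_simps using t[of i] by linarith
  moreover have "a i \<le> upper a b t j i \<and> b i \<le> upper a b t j i" for i
  proof (cases i)
    case (Suc n)
    then show ?thesis unfolding Suc upper_simps using t[of n] by linarith
  qed (simp add: le_max_iff_disj trans_le_add1)
  ultimately show "interlaces a (upper a b t j)" "interlaces b (upper a b t j)"
    by (auto simp: interlaces_def)
  show "lower a b (upper a b t j) = t"
  proof
    show "lower a b (upper a b t j) i = t i" for i
      unfolding lower_def upper_simps using t[of i] by linarith
  qed
  show "excess a b (upper a b t j) = j" by (simp add: excess_def)
qed

text \<open>Each pair contributes \<open>s (Suc i) + t i = max (a (Suc i)) (b (Suc i)) + min (a i)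
  (b i)\<close>, where \<open>s\<close> is the upper neighbour. Pairing the maximum and minimum at
  equal indices gives \<open>a i + b i\<close>.\<close>

lemma fsize_upper:
  assumes "interlaces t a" "interlaces t b" "vanishing t"
  shows "fsize (upper a b t j) + fsize t = fsize a + fsize b + j"
proof -
  have "vanishing a" "vanishing b"
    using assms interlaces_vanishing by blast+
  then obtain N where N: "\<And>i. i \<ge> N \<Longrightarrow> a i = 0 \<and> b i = 0 \<and> t i = 0"
    using assms(3) by (metis vanishing_common)
  have t: "t i \<le> a i" "t i \<le> b i" for i
    using assms by (auto simp: interlaces_def)
  have "(\<Sum>i<Suc n. upper a b t j i) + (\<Sum>i<n. t i) =
      (\<Sum>i<n. a i) + (\<Sum>i<n. b i) + max (a n) (b n) + j" for n
  proof (induction n)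
    case (Suc n)
    have "upper a b t j (Suc n) + t n + max (a n) (b n) = a n + b n + max (a (Suc n)) (b (Suc n))"
      unfolding upper_simps using t[of n] by linarith
    with Suc show ?case unfolding sum.lessThan_Suc by linarith
  qed simp
  from this[of N] have "(\<Sum>i<Suc N. upper a b t j i) + (\<Sum>i<N. t i) =
      (\<Sum>i<N. a i) + (\<Sum>i<N. b i) + j" using N by simp
  moreover have "upper a b t j i = 0" if "i \<ge> Suc N" for i
    using N that by (cases i) auto
  ultimately show ?thesis
    using fsize_eq[of N a] fsize_eq[of N b] fsize_eq[of N t] fsize_eq[of "Suc N" "upper a b t j"] N
    by auto
qed

section \<open>Exchanging two adjacent steps\<close>

text \<open>
  A tableau as the sequence of the row length functions of
  \<open>S\<^sup>0, S'\<^sup>1, S\<^sup>1, S'\<^sup>2, \<dots>, S'\<^sup>k, S\<^sup>k\<close>, with zeros afterwards.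
\<close>

definition osc :: "nat \<Rightarrow> nat list \<Rightarrow> (nat \<Rightarrow> nat \<Rightarrow> nat) set" where
  "osc k p = {P. P 0 = (\<lambda>_. 0) \<and> (\<forall>n>2 * k. P n = (\<lambda>_. 0)) \<and>
     (\<forall>i<k. interlaces (P (2 * i + 1)) (P (2 * i)) \<and> interlaces (P (2 * i + 1)) (P (2 * i + 2))) \<and>
     P (2 * k) = row p}"

definition osc_weight :: "nat \<Rightarrow> (nat \<Rightarrow> nat \<Rightarrow> nat) \<Rightarrow> monomial" where
  "osc_weight k P j = (if j \<in> {1..k} then (fsize (P (2 * j - 2)) - fsize (P (2 * j - 1))) +
     (fsize (P (2 * j)) - fsize (P (2 * j - 1))) else 0)"

text \<open>The shapes \<open>P (2 * i)\<close> and \<open>P (2 * i + 4)\<close> around steps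
  \<open>i + 1\<close> and \<open>i + 2\<close> stay fixed. The peak \<open>s\<close> between the
  valleys \<open>a\<close> and \<open>b\<close> is traded for the common lower neighbour
  \<open>t\<close> and the excess. Then \<open>a\<close> and \<open>b\<close> are reflected over
  \<open>t\<close>, and a new peak is built from the same \<open>t\<close> and excess.\<close>

definition swap_steps :: "nat \<Rightarrow> (nat \<Rightarrow> nat \<Rightarrow> nat) \<Rightarrow> nat \<Rightarrow> nat \<Rightarrow> nat" where
  "swap_steps i P = (let a = P (2 * i + 1); s = P (2 * i + 2); b = P (2 * i + 3);
      t = lower a b s; a' = reflect (P (2 * i)) t a; b' = reflect (P (2 * i + 4)) t b
    in P(2 * i + 1 := a', 2 * i + 2 := upper a' b' t (excess a b s), 2 * i + 3 := b'))"

lemma osc_vanishing: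
  assumes "P \<in> osc k p"
  shows "vanishing (P n)"
proof -
  have "vanishing (P (2 * i))" if "i \<le> k" for i
    using that
  proof (induction i)
    case 0
    then show ?case using assms by (simp add: osc_def vanishing_def)
  next
    case (Suc i)
    then have "interlaces (P (2 * i + 1)) (P (2 * i))" "interlaces (P (2 * i + 1)) (P (2 * i + 2))"
      using assms by (auto simp: osc_def)
    with Suc show ?case using interlaces_vanishing by force
  qed
  moreover have "vanishing (P (2 * i + 1))" if "i < k" for i
    using calculation[of i] assms that interlaces_vanishing by (fastforce simp: osc_def)
  moreover have "vanishing (P n)" if "n > 2 * k"
    using assms that by (simp add: osc_def vanishing_def)
  ultimately show ?thesis
    by (cases "n > 2 * k"; cases "even n") (auto elim!: evenE oddE)
qed

text \<open>The new middle shapes have the same \<open>t\<close> and excess as the old ones, so a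
  second application reflects \<open>a'\<close> and \<open>b'\<close> back and restores the
  peak.\<close>

lemma swap_steps:
  assumes P: "P \<in> osc k p" and i: "Suc i < k"
  shows "swap_steps i P \<in> osc k p" "swap_steps i (swap_steps i P) = P"
    "osc_weight k (swap_steps i P) = osc_weight k P \<circ> transpose (i + 1) (i + 2)"
proof -
  define c where "c = P (2 * i)"
  define a where "a = P (2 * i + 1)"
  define s where "s = P (2 * i + 2)"
  define b where "b = P (2 * i + 3)"
  define d where "d = P (2 * i + 4)"
  define t where "t = lower a b s"
  define j where "j = excess a b s"
  define a' where "a' = reflect c t a"
  define b' where "b' = reflect d t b"
  define s' where "s' = upper a' b' t j"
  define Q where "Q = P(2 * i + 1 := a', 2 * i + 2 := s', 2 * i + 3 := b')"
  have Q: "swap_steps i P = Q"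
    by (simp add: swap_steps_def Let_def Q_def a'_def s'_def b'_def t_def j_def a_def s_def b_def c_def d_def)
  have il: "interlaces (P (2 * n + 1)) (P (2 * n))" "interlaces (P (2 * n + 1)) (P (2 * n + 2))"
    if "n < k" for n using P that by (auto simp: osc_def)
  have ac: "interlaces a c" and as: "interlaces a s" and bs: "interlaces b s" and bd: "interlaces b d"
    using il[of i] il[of "Suc i"] i
    by (auto simp: a_def b_def c_def d_def s_def eval_nat_numeral)
  have ta: "interlaces t a" and tb: "interlaces t b" and s: "upper a b t j = s"
    unfolding t_def j_def using lower[OF as bs] by auto
  have ta': "interlaces t a'" and ac': "interlaces a' c" and a'': "reflect c t a' = a"
    unfolding a'_def using reflect[OF ta ac] by auto
  have tb': "interlaces t b'" and bd': "interlaces b' d" and b'': "reflect d t b' = b"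
    unfolding b'_def using reflect[OF tb bd] by auto
  have as': "interlaces a' s'" and bs': "interlaces b' s'"
    and t': "lower a' b' s' = t" and j': "excess a' b' s' = j"
    unfolding s'_def using upper[OF ta' tb'] by auto
  have Qv: "Q (2 * i) = c" "Q (2 * i + 1) = a'" "Q (2 * i + 2) = s'" "Q (2 * i + 3) = b'"
    "Q (2 * i + 4) = d"
    by (simp_all add: Q_def c_def d_def)
  show "swap_steps i (swap_steps i P) = P"
    unfolding Q unfolding swap_steps_def Let_def Qv t' j' a'' b'' s
    by (auto simp: Q_def a_def b_def s_def fun_eq_iff)
  have Qo: "Q n = P n" if "n \<le> 2 * i \<or> n \<ge> 2 * i + 4" for n
    using that by (auto simp: Q_def)
  have ilQ: "interlaces (Q (2 * n + 1)) (Q (2 * n)) \<and> interlaces (Q (2 * n + 1)) (Q (2 * n + 2))"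
    if "n < k" for n
  proof -
    consider "n < i" | "n = i" | "n = Suc i" | "n > Suc i" by linarith
    then show ?thesis
    proof cases
      case 2
      show ?thesis unfolding 2 Qv using ac' as' by simp
    next
      case 3
      have "2 * n + 1 = 2 * i + 3" "2 * n = 2 * i + 2" "2 * n + 2 = 2 * i + 4" using 3 by auto
      then have "Q (2 * n + 1) = b'" "Q (2 * n) = s'" "Q (2 * n + 2) = d"
        using Qv by metis+
      then show ?thesis using bs' bd' by simp
    qed (use il[OF that] Qo in auto)
  qed
  show osc: "swap_steps i P \<in> osc k p"
    unfolding Q using ilQ P i by (auto simp: osc_def Qo)
  have van: "vanishing c" "vanishing d" "vanishing s" "vanishing s'" "vanishing t"
    using osc_vanishing[OF P] osc_vanishing[OF osc] Qv interlaces_vanishing[OF ta]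
    unfolding Q by (metis c_def d_def s_def a_def)+
  \<comment> \<open>Writing shapes for their sizes, these equations turn both the new weight of step
    \<open>i + 1\<close> and the old weight of step \<open>i + 2\<close> into
    \<open>a + d + j - b - t\<close>. The other pair equals
    \<open>b + c + j - a - t\<close>.\<close>
  have size: "fsize a + fsize a' = fsize c + fsize t" "fsize b + fsize b' = fsize d + fsize t"
    "fsize s + fsize t = fsize a + fsize b + j" "fsize s' + fsize t = fsize a' + fsize b' + j"
    using fsize_reflect[OF ta ac] fsize_reflect[OF tb bd] fsize_upper[OF ta tb]
      fsize_upper[OF ta' tb'] van s by (auto simp: a'_def b'_def s'_def)
  \<comment> \<open>The weights are truncated differences; these bounds make them exact.\<close>
  have le: "fsize a \<le> fsize c" "fsize a \<le> fsize s" "fsize b \<le> fsize s" "fsize b \<le> fsize d"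
    "fsize a' \<le> fsize c" "fsize a' \<le> fsize s'" "fsize b' \<le> fsize s'" "fsize b' \<le> fsize d"
    using interlaces_fsize ac as bs bd ac' as' bs' bd' van by auto
  have w: "osc_weight k P (i + 1) = (fsize c - fsize a) + (fsize s - fsize a)"
    "osc_weight k P (i + 2) = (fsize s - fsize b) + (fsize d - fsize b)"
    using i by (auto simp: osc_weight_def a_def b_def c_def d_def s_def eval_nat_numeral)
  have w': "osc_weight k Q (i + 1) = (fsize c - fsize a') + (fsize s' - fsize a')"
    "osc_weight k Q (i + 2) = (fsize s' - fsize b') + (fsize d - fsize b')"
    using i Qv by (auto simp: osc_weight_def eval_nat_numeral)
  show "osc_weight k (swap_steps i P) = osc_weight k P \<circ> transpose (i + 1) (i + 2)"
  proof
    fix n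
    consider "n = i + 1" | "n = i + 2" | "n \<le> i" | "n > i + 2" by linarith
    then show "osc_weight k (swap_steps i P) n = (osc_weight k P \<circ> transpose (i + 1) (i + 2)) n"
    proof cases
      case 1
      then show ?thesis unfolding Q using w w' size le by simp
    next
      case 2
      then show ?thesis unfolding Q using w w' size le by simp
    next
      case 3
      have "Q (2 * n - 2) = P (2 * n - 2)" "Q (2 * n - 1) = P (2 * n - 1)" "Q (2 * n) = P (2 * n)"
        by (rule Qo, use 3 in linarith)+
      then have "osc_weight k Q n = osc_weight k P n"
        by (simp only: osc_weight_def)
      then show ?thesis unfolding Q using 3 by (simp add: transpose_def)
    next
      case 4
      have "Q (2 * n - 2) = P (2 * n - 2)" "Q (2 * n - 1) = P (2 * n - 1)" "Q (2 * n) = P (2 * n)"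
        by (rule Qo, use 4 in linarith)+
      then have "osc_weight k Q n = osc_weight k P n"
        by (simp only: osc_weight_def)
      then show ?thesis unfolding Q using 4 by (simp add: transpose_def)
    qed
  qed
qed

text \<open>The involution \<open>swap_steps i\<close> maps the two weight classes onto each
  other.\<close>

lemma card_osc_transpose:
  assumes "Suc i < k"
  shows "card {P \<in> osc k p. osc_weight k P = b \<circ> transpose (i + 1) (i + 2)} =
    card {P \<in> osc k p. osc_weight k P = b}"
proof (rule bij_betw_same_card)
  have inv: "b \<circ> transpose (i + 1) (i + 2) \<circ> transpose (i + 1) (i + 2) = b" for b :: monomial
    by (simp add: comp_assoc)
  show "bij_betw (swap_steps i) {P \<in> osc k p. osc_weight k P = b \<circ> transpose (i + 1) (i + 2)}
    {P \<in> osc k p. osc_weight k P = b}"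
    by (rule bij_betw_byWitness[where f' = "swap_steps i"])
      (auto simp: swap_steps[OF _ assms] inv)
qed

section \<open>Tableaux as sequences of row lengths\<close>

text \<open>The list begins with \<open>S\<^sup>1\<close>, which has position 2 in the sequence;
  positions 0 and 1 hold the empty shapes \<open>S\<^sup>0\<close> and
  \<open>S'\<^sup>1\<close>.\<close>

definition rows :: "nat \<Rightarrow> nat list list \<Rightarrow> nat \<Rightarrow> nat \<Rightarrow> nat" where
  "rows k S n = (if 2 \<le> n \<and> n \<le> 2 * k then row (S ! (n - 2)) else (\<lambda>_. 0))"

lemma rows_outer: "i \<le> k \<Longrightarrow> rows k S (2 * i) = row (outer S i)"
  by (auto simp: rows_def outer_def)

lemma rows_inner: "i < k \<Longrightarrow> rows k S (2 * i + 1) = row (inner S (i + 1))"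
  by (auto simp: rows_def inner_def)

lemma is_partition_outer_inner:
  assumes "length S = 2 * k - 1" "\<forall>q\<in>set S. is_partition q" "i \<le> k"
  shows "is_partition (outer S i)" "is_partition (inner S i)"
  using assms by (auto simp: outer_def inner_def is_partition_def[of "[]"])

lemma SSOT_iff_osc:
  assumes "length S = 2 * k - 1" "\<forall>q\<in>set S. is_partition q" "is_partition p" "k \<ge> 1"
  shows "S \<in> SSOT k p \<longleftrightarrow> rows k S \<in> osc k p"
proof -
  have part: "is_partition (outer S i)" "is_partition (inner S i)" if "i \<le> k" for i
    using is_partition_outer_inner[OF assms(1,2) that] .
  have "(\<forall>i\<in>{1..<k}. diagram (inner S (i + 1)) \<subseteq> diagram (outer S i) \<and>
        horizontal_strip (diagram (outer S i) - diagram (inner S (i + 1)))) \<longleftrightarrow>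
      (\<forall>i\<in>{1..<k}. interlaces (rows k S (2 * i + 1)) (rows k S (2 * i)))"
    by (intro ball_cong refl) (simp add: rows_outer rows_inner[simplified] horizontal_strip_iff_interlaces part)
  \<comment> \<open>The deletion in step 1 is not among the conditions of \<open>SSOT\<close>; it
    goes from the empty shape to itself.\<close>
  moreover have "\<dots> \<longleftrightarrow> (\<forall>i<k. interlaces (rows k S (2 * i + 1)) (rows k S (2 * i)))"
  proof -
    have "interlaces (rows k S (2 * 0 + 1)) (rows k S (2 * 0))"
      by (simp add: rows_def interlaces_def)
    then show ?thesis by (metis One_nat_def atLeastLessThan_iff less_one linorder_not_le)
  qed
  moreover have "(\<forall>i\<in>{1..k}. diagram (inner S i) \<subseteq> diagram (outer S i) \<and>
        horizontal_strip (diagram (outer S i) - diagram (inner S i))) \<longleftrightarrow>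
      (\<forall>i\<in>{1..k}. interlaces (row (inner S i)) (row (outer S i)))"
    by (intro ball_cong refl horizontal_strip_iff_interlaces) (auto simp: part)
  moreover have "\<dots> \<longleftrightarrow> (\<forall>i<k. interlaces (rows k S (2 * i + 1)) (rows k S (2 * i + 2)))"
  proof -
    have "{1..k} = Suc ` {..<k}" by (simp add: image_Suc_lessThan)
    moreover have "rows k S (2 * i + 2) = row (outer S (Suc i))" if "i < k" for i
      using rows_outer[of "Suc i" k S] that by simp
    ultimately show ?thesis using rows_inner[of _ k S] by auto
  qed
  moreover have "outer S k = p \<longleftrightarrow> rows k S (2 * k) = row p"
    using rows_outer[of k k S] of_rows_row part[of k] assms(3) by (metis order_refl)
  moreover have "rows k S 0 = (\<lambda>_. 0)" "\<forall>n>2 * k. rows k S n = (\<lambda>_. 0)"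
    by (auto simp: rows_def)
  ultimately show ?thesis using assms(1,2) unfolding SSOT_def osc_def by blast
qed

lemma bij_betw_rows:
  assumes "is_partition p" "k \<ge> 1"
  shows "bij_betw (rows k) (SSOT k p) (osc k p)"
proof (rule bij_betw_imageI)
  show "inj_on (rows k) (SSOT k p)"
  proof (rule inj_onI)
    fix S T assume S: "S \<in> SSOT k p" and T: "T \<in> SSOT k p" and eq: "rows k S = rows k T"
    have len: "length S = 2 * k - 1" "length T = 2 * k - 1" using S T by (auto simp: SSOT_def)
    show "S = T"
    proof (rule nth_equalityI)
      fix n assume n: "n < length S"
      then have "n + 2 \<le> 2 * k" using len by simp
      then have "rows k R (n + 2) = row (R ! n)" for R
        by (simp add: rows_def numeral_2_eq_2)
      then have "row (S ! n) = row (T ! n)" using eq by metis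
      moreover have "is_partition (S ! n)" "is_partition (T ! n)"
        using S T n len by (auto simp: SSOT_def)
      ultimately show "S ! n = T ! n" by (metis of_rows_row)
    qed (simp add: len)
  qed
  have "P \<in> rows k ` SSOT k p" if P: "P \<in> osc k p" for P
  proof -
    define S where "S = map (\<lambda>n. of_rows (P (n + 2))) [0..<2 * k - 1]"
    have anti: "antimono (P n)" if "n \<le> 2 * k" for n
    proof (cases "even n")
      case True
      then obtain i where i: "n = 2 * i" by blast
      show ?thesis
      proof (cases i)
        case 0
        then show ?thesis using P i by (simp add: osc_def antimono_def)
      next
        case (Suc m)
        then have "interlaces (P (2 * m + 1)) (P (2 * m + 2))"
          using P i that by (auto simp: osc_def)
        from interlaces_antimono(1)[OF this] show ?thesis using i Suc by simp
      qed
    next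
      case False
      then obtain i where i: "n = 2 * i + 1" using oddE by blast
      then have "interlaces (P n) (P (2 * i))" using P that by (auto simp: osc_def)
      then show ?thesis by (rule interlaces_antimono)
    qed
    note R = row_of_rows[OF anti osc_vanishing[OF P]]
    \<comment> \<open>\<open>osc\<close> prescribes only \<open>P 0\<close>; the shape
      \<open>P 1\<close> lies below it and so is empty, as \<open>rows\<close> demands.\<close>
    have "P 1 = (\<lambda>_. 0)"
    proof -
      have "interlaces (P (2 * 0 + 1)) (P (2 * 0))" "P 0 = (\<lambda>_. 0)"
        using P assms(2) by (auto simp: osc_def)
      then show ?thesis by (simp add: interlaces_def fun_eq_iff)
    qed
    then have small: "P n = (\<lambda>_. 0)" if "n < 2" for n
      using P that by (auto simp: osc_def less_2_cases_iff)
    have eq: "rows k S = P"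
    proof
      fix n
      show "rows k S n = P n"
      proof (cases "2 \<le> n \<and> n \<le> 2 * k")
        case True
        then have "n - 2 < 2 * k - 1" by linarith
        then have "S ! (n - 2) = of_rows (P (n - 2 + 2))" by (simp add: S_def)
        also have "n - 2 + 2 = n" using True by linarith
        finally have "S ! (n - 2) = of_rows (P n)" .
        then show ?thesis using True R by (simp add: rows_def)
      next
        case False
        then have "P n = (\<lambda>_. 0)" using small P by (auto simp: osc_def)
        then show ?thesis using False by (auto simp: rows_def)
      qed
    qed
    have "length S = 2 * k - 1" "\<forall>q\<in>set S. is_partition q"
      using R by (auto simp: S_def)
    from SSOT_iff_osc[OF this assms] have "S \<in> SSOT k p" using P eq by simp
    then show ?thesis using eq by blast
  qed
  moreover have "rows k S \<in> osc k p" if "S \<in> SSOT k p" for S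
    using that SSOT_iff_osc[of S k p] assms by (auto simp: SSOT_def)
  ultimately show "rows k ` SSOT k p = osc k p" by blast
qed

lemma osc_weight_rows:
  assumes S: "S \<in> SSOT k p"
  shows "osc_weight k (rows k S) = weight k S"
proof
  fix j
  show "osc_weight k (rows k S) j = weight k S j"
  proof (cases "j \<in> {1..k}")
    case True
    then obtain i where i: "j = Suc i" "i < k" by (cases j) auto
    have "diagram (inner S j) \<subseteq> diagram (outer S j)"
      using S True by (simp add: SSOT_def)
    moreover have "diagram (inner S (Suc i)) \<subseteq> diagram (outer S i)"
    proof (cases "i = 0")
      case True
      then show ?thesis by (simp add: inner_def diagram_def)
    next
      case False
      then show ?thesis using S i by (simp add: SSOT_def)
    qed
    ultimately have "card (deleted S j) = fsize (row (outer S i)) - fsize (row (inner S j))"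
      "card (added S j) = fsize (row (outer S j)) - fsize (row (inner S j))"
      using i by (simp_all add: deleted_def added_def card_Diff_subset finite_diagram card_diagram)
    moreover have "rows k S (2 * j - 2) = row (outer S i)" "rows k S (2 * j - 1) = row (inner S j)"
      "rows k S (2 * j) = row (outer S j)"
      using rows_outer[of i k S] rows_outer[of j k S] rows_inner[of i k S] i by simp_all
    ultimately show ?thesis using True by (simp add: osc_weight_def weight_eq)
  qed (auto simp: osc_weight_def weight_eq)
qed

section \<open>Coefficients as cardinalities, and invariance under all permutations\<close>

lemma ss_eq_card_osc:
  assumes "is_partition p" "k \<ge> 1"
  shows "ss k p b = int (card {P \<in> osc k p. osc_weight k P = b})"
proof -
  have "ss k p b = (\<Sum>S\<in>{S \<in> SSOT k p. weight k S = b}. 1)"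
    unfolding ss_def series_sum_def by (intro sum.cong) (auto simp: monomial_series_def)
  also have "\<dots> = int (card {S \<in> SSOT k p. weight k S = b})" by simp
  also have "card {S \<in> SSOT k p. weight k S = b} = card {P \<in> osc k p. osc_weight k P = b}"
  proof (rule bij_betw_same_card[of "rows k"])
    have "{S \<in> SSOT k p. weight k S = b} = {S \<in> SSOT k p. osc_weight k (rows k S) = b}"
      using osc_weight_rows by auto
    then have "rows k ` {S \<in> SSOT k p. weight k S = b} = {P \<in> rows k ` SSOT k p. osc_weight k P = b}"
      by auto
    also have "rows k ` SSOT k p = osc k p"
      using bij_betw_rows[OF assms] by (rule bij_betw_imp_surj_on)
    finally have "rows k ` {S \<in> SSOT k p. weight k S = b} = {P \<in> osc k p. osc_weight k P = b}" .
    then show "bij_betw (rows k) {S \<in> SSOT k p. weight k S = b} {P \<in> osc k p. osc_weight k P = b}"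
      by (intro bij_betw_subset[OF bij_betw_rows[OF assms]]) auto
  qed
  finally show ?thesis .
qed

text \<open>Adjacent transpositions generate all permutations of an interval: transpositions are
  handled by induction on the distance of the two points, and permutations as products of
  transpositions.\<close>

lemma permutes_adjacent_invariant:
  fixes F :: "(nat \<Rightarrow> 'a) \<Rightarrow> 'b"
  assumes adjacent: "\<And>i b. m \<le> i \<Longrightarrow> i < k \<Longrightarrow> F (b \<circ> transpose i (Suc i)) = F b"
    and "\<pi> permutes {m..k}"
  shows "F (b \<circ> \<pi>) = F b"
proof -
  have shift: "F (b \<circ> transpose i (i + Suc n)) = F b" if "m \<le> i" "i + Suc n \<le> k" for i n b
    using that(2)
  proof (induction n arbitrary: b)
    case 0
    then show ?case using adjacent[of i b] that(1) by (simp add: comp_def)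
  next
    case (Suc n)
    let ?t = "transpose (i + Suc n) (Suc (i + Suc n))"
    \<comment> \<open>Conjugating with the adjacent transposition \<open>?t\<close> moves the right
      end one place further.\<close>
    have "transpose i (i + Suc (Suc n)) = ?t \<circ> transpose i (i + Suc n) \<circ> ?t"
      by (auto simp: transpose_def fun_eq_iff)
    then have "F (b \<circ> transpose i (i + Suc (Suc n))) = F (b \<circ> ?t \<circ> transpose i (i + Suc n) \<circ> ?t)"
      by (simp only: comp_assoc)
    also have "\<dots> = F (b \<circ> ?t \<circ> transpose i (i + Suc n))"
      using adjacent[of "i + Suc n"] Suc.prems that(1) by simp
    also have "\<dots> = F (b \<circ> ?t)" using Suc.IH[of "b \<circ> ?t"] Suc.prems by (simp add: comp_def)
    also have "\<dots> = F b" using adjacent[of "i + Suc n"] Suc.prems that(1) by simp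
    finally show ?case .
  qed
  have less: "F (b \<circ> transpose i j) = F b" if "m \<le> i" "i < j" "j \<le> k" for i j b
    using shift[of i "j - Suc i" b] that by simp
  have transp: "F (b \<circ> transpose i j) = F b" if "i \<in> {m..k}" "j \<in> {m..k}" for i j b
    using less[of i j b] less[of j i b] that by (cases i j rule: linorder_cases) (auto simp: transpose_commute)
  have "\<forall>b. F (b \<circ> \<pi>) = F b"
    using assms(2)
  proof (rule permutes_induct[where P = "\<lambda>\<pi>. \<forall>b. F (b \<circ> \<pi>) = F b"])
    fix i j \<rho> assume ij: "i \<in> {m..k}" "j \<in> {m..k}" and IH: "\<forall>b. F (b \<circ> \<rho>) = F b"
    show "\<forall>b. F (b \<circ> (transpose i j \<circ> \<rho>)) = F b"
      using IH transp[OF ij] by (simp flip: comp_assoc)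
  qed simp_all
  then show ?thesis ..
qed

theorem theorem4p28:
  fixes k :: nat and lam :: "nat list"
  assumes "k \<ge> 1" and "is_partition lam" and "length lam \<le> k"
  shows "symmetric_series k (ss k lam)"
proof -
  have "ss k lam (b \<circ> \<pi>) = ss k lam b" if "\<pi> permutes {1..k}" for \<pi> b
  proof (rule permutes_adjacent_invariant[OF _ that])
    fix i and b :: monomial assume "1 \<le> i" "i < k"
    \<comment> \<open>Variables are numbered from 1, whereas \<open>swap_steps n\<close> exchanges
      steps \<open>n + 1\<close> and \<open>n + 2\<close>.\<close>
    then obtain n where n: "i = n + 1" "Suc n < k" by (cases i) auto
    show "ss k lam (b \<circ> transpose i (Suc i)) = ss k lam b"
      using card_osc_transpose[OF n(2), of lam b] n(1) assms by (simp add: ss_eq_card_osc)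
  qed
  then show ?thesis by (simp add: symmetric_series_def permute_vars_def fun_eq_iff)
qed

end
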